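(* For every $n\ge 2$, $f_6(n)\le\lceil\log_2 n\rceil+2\lceil\sqrt{\log_2 n}\,\rceil+2$.
   Context: Model 6 (adaptive, three players $A,B,C$). $X$ is an $n$-element set of distinguishable elements and Player $A$ (the adversary) chooses an unknown defective element $d\in X$. Players $B$ and $C$ may agree on a (deterministic) questioning strategy before the process starts, but cannot communicate afterwards except through the rules below. At each step Player $A$ decides which of $B$ and $C$ asks the next query; a query is a subset $Q\subseteq X$, whose answer is YES iff $d\in Q$. The player asking a query obtains its answer. If the answer to a query asked by $B$ is YES, then $C$ also learns the query set and that the answer was YES; similarly for queries asked by $C$ and answered YES, $B$ learns the set and the answer. If the answer is NO, the non-asking player learns nothing (not even that a query was asked). Each player's queries may depend only on the information that player has. The goal is that both $B$ and $C$ can identify $d$. $f_6(n)$ is the minimum $N$ such that $B$ and $C$ have a strategy guaranteeing that, whatever $d$ and whatever order of questioners $A$ chooses, the goal is reached after at most $N$ queries in total. *)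

theory Defs
  imports Complex_Main
begin

datatype player = Player_B | Player_C

(* What a player experiences, in chronological order: the outcomes of the player's own
   queries (True is YES), and the queries of the other player that were answered YES.
   A query of the other player that is answered NO leaves no trace, so a player has no
   access to the total number of queries asked so far. *)
datatype 'a event = Own "'a set" bool | Other_Yes "'a set"

type_synonym 'a view = "'a event list"

(* A pair of deterministic questioning strategies agreed on in advance: the next query of
   a player is a function of this player's own view only. *)
type_synonym 'a strategy = "player \<Rightarrow> 'a view \<Rightarrow> 'a set"

definition strategy_on :: "'a set \<Rightarrow> 'a strategy \<Rightarrow> bool" where
  "strategy_on X S \<longleftrightarrow> (\<forall>p v. S p v \<subseteq> X)"

definition ask :: "'a strategy \<Rightarrow> 'a \<Rightarrow> player \<Rightarrow> (player \<Rightarrow> 'a view) \<Rightarrow> (player \<Rightarrow> 'a view)" where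
  "ask S d p V =
     (let Q = S p (V p) in
      if d \<in> Q then (\<lambda>r. V r @ [if r = p then Own Q True else Other_Yes Q])
      else V(p := V p @ [Own Q False]))"

(* The views of both players after the queries have been asked by the players listed in
   the given order, d being the defective element. *)
definition views :: "'a strategy \<Rightarrow> 'a \<Rightarrow> player list \<Rightarrow> player \<Rightarrow> 'a view" where
  "views S d \<sigma> = fold (ask S d) \<sigma> (\<lambda>_. [])"

(* The elements that a player with view v, who knows both strategies but not the order of
   the questioners, cannot exclude. *)
definition candidates :: "'a set \<Rightarrow> 'a strategy \<Rightarrow> player \<Rightarrow> 'a view \<Rightarrow> 'a set" where
  "candidates X S p v = {d \<in> X. \<exists>\<sigma>. views S d \<sigma> p = v}"

definition goal_reached :: "'a set \<Rightarrow> 'a strategy \<Rightarrow> 'a \<Rightarrow> player list \<Rightarrow> bool" where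
  "goal_reached X S d \<sigma> \<longleftrightarrow> (\<forall>p. candidates X S p (views S d \<sigma> p) = {d})"

(* Since the strategies are deterministic, an adversary choosing the questioners
   adaptively is covered by quantifying over all orders of questioners. *)
definition guarantees :: "'a set \<Rightarrow> 'a strategy \<Rightarrow> nat \<Rightarrow> bool" where
  "guarantees X S N \<longleftrightarrow>
     (\<forall>d\<in>X. \<forall>\<sigma>. length \<sigma> = N \<longrightarrow> (\<exists>t\<le>N. goal_reached X S d (take t \<sigma>)))"

definition f6 :: "nat \<Rightarrow> nat" where
  "f6 n = (LEAST N. \<exists>S. strategy_on {..<n} S \<and> guarantees {..<n} S N)"

lemma views_Nil [simp]: "views S d [] p = []"
  by (simp add: views_def)

lemma views_snoc: "views S d (\<sigma> @ [q]) = ask S d q (views S d \<sigma>)"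
  by (simp add: views_def)

lemma views_yes:
  assumes "Own Q True \<in> set (views S d \<sigma> p) \<or> Other_Yes Q \<in> set (views S d \<sigma> p)"
  shows "d \<in> Q"
  using assms
  by (induction \<sigma> arbitrary: p rule: rev_induct)
    (auto simp: views_snoc ask_def Let_def split: if_splits)

(* The minimum in the definition of f6 is attained. *)
lemma ex_guarantees: "\<exists>N S. strategy_on {..<n::nat} S \<and> guarantees {..<n} S N"
proof -
  define S :: "nat strategy" where "S = (\<lambda>p v. {length v} \<inter> {..<n})"
  have main: "(\<forall>p. \<exists>Q\<subseteq>{d}. Own Q True \<in> set (views S d \<sigma> p) \<or> Other_Yes Q \<in> set (views S d \<sigma> p))
      \<or> (\<forall>p. length (views S d \<sigma> p) \<le> d) \<and>
        length \<sigma> = length (views S d \<sigma> Player_B) + length (views S d \<sigma> Player_C)"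
    if d: "d < n" for d \<sigma>
  proof (induction \<sigma> rule: rev_induct)
    case Nil
    then show ?case by simp
  next
    case (snoc q \<sigma>)
    let ?V = "views S d \<sigma>"
    show ?case
    proof (cases "d \<in> S q (?V q)")
      case True
      then have "S q (?V q) \<subseteq> {d}" by (auto simp: S_def)
      then show ?thesis using True
        by (intro disjI1 allI exI[of _ "S q (?V q)"]) (auto simp: views_snoc ask_def Let_def)
    next
      case False
      then have ne: "length (?V q) \<noteq> d" using d by (auto simp: S_def)
      from snoc.IH show ?thesis
      proof
        assume A: "\<forall>p. \<exists>Q\<subseteq>{d}. Own Q True \<in> set (?V p) \<or> Other_Yes Q \<in> set (?V p)"
        have "set (?V p) \<subseteq> set (views S d (\<sigma> @ [q]) p)" for p
          using False by (auto simp: views_snoc ask_def Let_def)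
        then show ?thesis using A by (meson subsetD)
      next
        assume A: "(\<forall>p. length (?V p) \<le> d) \<and>
          length \<sigma> = length (?V Player_B) + length (?V Player_C)"
        then have "length (?V q) < d" using ne by (simp add: le_neq_implies_less)
        then show ?thesis using A False
          by (intro disjI2) (cases q; auto simp: views_snoc ask_def Let_def)
      qed
    qed
  qed
  have "goal_reached {..<n} S d \<sigma>" if d: "d < n" and l: "length \<sigma> = 2 * n" for d \<sigma>
  proof -
    have "\<not> (\<forall>p. length (views S d \<sigma> p) \<le> d) \<or>
        length \<sigma> \<noteq> length (views S d \<sigma> Player_B) + length (views S d \<sigma> Player_C)"
      using d l by (smt (verit) add_mono mult_2 not_le add_strict_mono)
    then have yes: "\<exists>Q\<subseteq>{d}. Own Q True \<in> set (views S d \<sigma> p) \<or> Other_Yes Q \<in> set (views S d \<sigma> p)" for p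
      using main[OF d, of \<sigma>] by blast
    have "candidates {..<n} S p (views S d \<sigma> p) = {d}" for p
    proof -
      obtain Q where Q: "Q \<subseteq> {d}"
        "Own Q True \<in> set (views S d \<sigma> p) \<or> Other_Yes Q \<in> set (views S d \<sigma> p)"
        using yes by blast
      have "d' = d" if "views S d' \<sigma>' p = views S d \<sigma> p" for d' \<sigma>'
        using views_yes[of Q S d' \<sigma>' p] Q that by auto
      then show ?thesis using d by (auto simp: candidates_def)
    qed
    then show ?thesis by (simp add: goal_reached_def)
  qed
  then have "guarantees {..<n} S (2 * n)"
    unfolding guarantees_def by (metis lessThan_iff order_refl take_all)
  moreover have "strategy_on {..<n} S" by (simp add: strategy_on_def S_def)
  ultimately show ?thesis by blast
qed

end

theory Submission
  imports Defs
begin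

text \<open>
  Identify the elements with bit strings of length \<open>L = \<lceil>log\<^sub>2 n\<rceil>\<close> and put \<open>s = \<lceil>sqrt (log\<^sub>2 n)\<rceil>\<close>.
  Player B asks for the lowest bit that B does not know yet, Player C for the highest one, always
  restricted to the elements consistent with the player's own view. Hence a YES publishes everything
  the asking player knows. A player who has accumulated \<open>s\<close> NOs since the last own YES, or who
  knows \<open>d\<close>, asks for the whole set of consistent elements, which forces a YES. Forced YES answers
  before the end publish disjoint sets of \<open>s\<close> bits each, so there are at most \<open>L / s \<le> s\<close> of them.
  As the two players work towards each other, bits are asked twice only when the two ranges meet,
  and those bits were all answered NO to one of the players since that player's last YES, so there
  are at most \<open>s\<close> of them. The final query costs one more.
\<close>

section \<open>Knowledge read off a view\<close>

fun consistent :: "'a \<Rightarrow> 'a event \<Rightarrow> bool" where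
  "consistent x (Own Q a) \<longleftrightarrow> (x \<in> Q \<longleftrightarrow> a)"
| "consistent x (Other_Yes Q) \<longleftrightarrow> x \<in> Q"

text \<open>Unlike \<open>candidates\<close>, this refers to no strategy, so a strategy can be
  defined from it without circularity.\<close>

definition consistent_set :: "'a set \<Rightarrow> 'a view \<Rightarrow> 'a set" where
  "consistent_set X v = {x \<in> X. \<forall>e\<in>set v. consistent x e}"

lemma consistent_set_subset: "consistent_set X v \<subseteq> X"
  by (auto simp: consistent_set_def)

lemma consistent_set_snoc:
  "consistent_set X (v @ [e]) = {x \<in> consistent_set X v. consistent x e}"
  by (auto simp: consistent_set_def)

lemma consistent_views: "e \<in> set (views S d \<sigma> p) \<Longrightarrow> consistent d e"
proof (induction \<sigma> arbitrary: p rule: rev_induct)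
  case (snoc q \<sigma>)
  then show ?case
    by (cases "d \<in> S q (views S d \<sigma> q)"; cases "p = q")
      (auto simp: views_snoc ask_def Let_def)
qed simp

lemma defective_consistent: "d \<in> X \<Longrightarrow> d \<in> consistent_set X (views S d \<sigma> p)"
  using consistent_views by (fastforce simp: consistent_set_def)

lemma candidates_subset_consistent_set: "candidates X S p v \<subseteq> consistent_set X v"
  using consistent_views by (fastforce simp: candidates_def consistent_set_def)

text \<open>\<open>d\<close> is always a candidate, witnessed by \<open>\<sigma>\<close> itself, and
  consistency bounds the candidates from above.\<close>

lemma goal_reachedI:
  assumes "d \<in> X" "\<And>p. consistent_set X (views S d \<sigma> p) \<subseteq> {d}"
  shows "goal_reached X S d \<sigma>"
proof -
  have "candidates X S p (views S d \<sigma> p) = {d}" for p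
    using assms candidates_subset_consistent_set[of X S p "views S d \<sigma> p"]
    by (fastforce simp: candidates_def)
  then show ?thesis by (simp add: goal_reached_def)
qed

section \<open>Bits left open by a set of possible elements\<close>

text \<open>A player can know a bit without having asked for it, through a YES of the other player
  or because \<open>n\<close> is not a power of two. Disagreement within \<open>K\<close> accounts
  for all these cases.\<close>

definition undetermined :: "nat \<Rightarrow> nat set \<Rightarrow> nat set" where
  "undetermined L K = {i. i < L \<and> (\<exists>x\<in>K. \<exists>y\<in>K. bit x i \<noteq> bit y i)}"

lemma undetermined_mono: "K \<subseteq> K' \<Longrightarrow> undetermined L K \<subseteq> undetermined L K'"
  by (auto simp: undetermined_def)

lemma undetermined_lt: "undetermined L K \<subseteq> {..<L}"
  by (auto simp: undetermined_def)

text \<open>Distinct numbers below \<open>2 ^ L\<close> differ in a bit below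
  \<open>L\<close>.\<close>

lemma undetermined_empty_iff:
  assumes "K \<subseteq> {..<2 ^ L}" "d \<in> K"
  shows "undetermined L K = {} \<longleftrightarrow> K = {d}"
proof
  assume *: "undetermined L K = {}"
  have "x = d" if "x \<in> K" for x
  proof -
    have "take_bit L x = take_bit L d"
      using * that assms(2) by (intro bit_eqI) (auto simp: bit_take_bit_iff undetermined_def)
    then show ?thesis
      using that assms by (auto simp: take_bit_nat_eq_self subset_iff)
  qed
  then show "K = {d}" using assms(2) by blast
qed (auto simp: undetermined_def)

section \<open>Opposite directions of the two players\<close>

fun next_bit :: "player \<Rightarrow> nat set \<Rightarrow> nat" where
  "next_bit Player_B U = Min U"
| "next_bit Player_C U = Max U"

text \<open>The side of \<open>i\<close> that the player has worked through on reaching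
  \<open>i\<close>. The sides of the two players share \<open>i\<close> and together cover
  everything.\<close>

fun passed :: "player \<Rightarrow> nat \<Rightarrow> nat set" where
  "passed Player_B i = {..i}"
| "passed Player_C i = {i..}"

fun other :: "player \<Rightarrow> player" where
  "other Player_B = Player_C"
| "other Player_C = Player_B"

lemma other_simps [simp]: "other p \<noteq> p" "p \<noteq> other p" "other (other p) = p"
  by (cases p; simp)+

lemma player_cases: "r = p \<or> r = other p"
  by (cases p; cases r) auto

lemma all_player_iff: "(\<forall>r. P r) \<longleftrightarrow> P p \<and> P (other p)"
  by (metis player_cases)

lemma ex_player_iff: "(\<exists>r. P r) \<longleftrightarrow> P p \<or> P (other p)"
  by (metis player_cases)

lemma passed_self: "i \<in> passed p i"
  by (cases p) auto

lemma passed_Un: "passed p i \<union> passed (other p) i = UNIV"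
  by (cases p) auto

lemma next_bit_in: "finite U \<Longrightarrow> U \<noteq> {} \<Longrightarrow> next_bit p U \<in> U"
  by (cases p) auto

lemma passed_next_bit: "finite U \<Longrightarrow> passed p (next_bit p U) \<inter> U \<subseteq> {next_bit p U}"
  by (cases p) (auto intro: antisym)

section \<open>The strategy\<close>

fun count_no :: "'a event \<Rightarrow> nat \<Rightarrow> nat" where
  "count_no (Own Q a) k = (if a then 0 else Suc k)"
| "count_no (Other_Yes Q) k = k"

text \<open>A YES of the other player reveals none of the player's own NO answers, so only an own
  YES resets the counter.\<close>

definition unpublished :: "'a view \<Rightarrow> nat" where
  "unpublished v = fold count_no v 0"

lemma unpublished_Nil [simp]: "unpublished [] = 0"
  by (simp add: unpublished_def)

lemma unpublished_snoc [simp]: "unpublished (v @ [e]) = count_no e (unpublished v)"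
  by (simp add: unpublished_def)

text \<open>Testing for equality with \<open>s\<close> is enough: the counter grows by one per NO,
  and at \<open>s\<close> the query \<open>K\<close> contains \<open>d\<close>, so the answer is YES
  and the counter restarts.\<close>

definition meet_strategy :: "nat \<Rightarrow> nat \<Rightarrow> nat \<Rightarrow> nat strategy" where
  "meet_strategy n L s p v =
     (let K = consistent_set {..<n} v; U = undetermined L K in
      if U = {} \<or> unpublished v = s then K else {x \<in> K. bit x (next_bit p U)})"

lemma strategy_on_meet_strategy: "strategy_on {..<n} (meet_strategy n L s)"
  using consistent_set_subset by (fastforce simp: strategy_on_def meet_strategy_def Let_def)

section \<open>The counting invariant and its bound\<close>

text \<open>
  In the following invariant, \<open>D p\<close> is the set of bits that Player \<open>p\<close> cannot determine, \<open>Q p\<close> the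
  set of bits \<open>p\<close> has asked for, \<open>U p\<close> the subset asked since the last own YES, \<open>m\<close> the
  number of forced YES answers, and \<open>t\<close> the number of queries so far.
\<close>

definition invar ::
  "nat \<Rightarrow> nat \<Rightarrow> (player \<Rightarrow> nat set) \<Rightarrow> (player \<Rightarrow> nat set) \<Rightarrow> (player \<Rightarrow> nat set) \<Rightarrow> nat \<Rightarrow> nat \<Rightarrow> bool" where
  "invar L s D Q U m t \<longleftrightarrow>
     (\<forall>p. U p \<subseteq> Q p \<and> Q p \<subseteq> {..<L} \<and> card (U p) \<le> s) \<and>
     (\<forall>p. (Q p - U p) \<inter> D (other p) = {}) \<and>
     (\<forall>p. \<forall>i\<in>Q p. passed p i \<inter> D p = {}) \<and>
     ((\<forall>p. Q p \<inter> Q (other p) \<subseteq> U p) \<or> (\<exists>p. Q p \<inter> Q (other p) \<subseteq> U p \<and> D p = {})) \<and>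
     t = (\<Sum>p\<in>{Player_B, Player_C}. card (Q p)) + m \<and>
     s * m \<le> (\<Sum>p\<in>{Player_B, Player_C}. card (Q p - U p))"

lemma sum_players:
  fixes f :: "player \<Rightarrow> nat"
  shows "(\<Sum>r\<in>{Player_B, Player_C}. f r) = f p + f (other p)"
  by (cases p) auto

text \<open>The invariant seen from one player \<open>p\<close>. If \<open>p\<close> still has open
  bits, only \<open>other p\<close> can be the player singled out in the overlap clause, so in
  either case the doubly asked bits lie in \<open>U (other p)\<close>.\<close>

lemma invarD:
  assumes "invar L s D Q U m t"
  shows "U p \<subseteq> Q p" "Q p \<subseteq> {..<L}" "card (U p) \<le> s" "finite (Q p)" "finite (U p)"
    and "Q p \<inter> D (other p) \<subseteq> U p"
    and "i \<in> Q p \<Longrightarrow> passed p i \<inter> D p = {}"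
    and "D p \<noteq> {} \<Longrightarrow> Q p \<inter> Q (other p) \<subseteq> U (other p)"
    and "D p \<noteq> {} \<Longrightarrow> Q p \<inter> Q (other p) \<subseteq> U p \<or> D (other p) = {}"
    and "t = card (Q p) + card (Q (other p)) + m"
    and "s * m \<le> card (Q p - U p) + card (Q (other p) - U (other p))"
proof -
  show sub: "U p \<subseteq> Q p" "Q p \<subseteq> {..<L}" "card (U p) \<le> s"
    using assms by (simp_all add: invar_def)
  then show "finite (Q p)" "finite (U p)" by (meson finite_lessThan finite_subset)+
  have "(Q p - U p) \<inter> D (other p) = {}" using assms by (simp add: invar_def)
  then show "Q p \<inter> D (other p) \<subseteq> U p" by blast
  show "passed p i \<inter> D p = {}" if "i \<in> Q p" using assms that by (simp add: invar_def)
  have "(Q p \<inter> Q (other p) \<subseteq> U p \<and> Q (other p) \<inter> Q p \<subseteq> U (other p)) \<or>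
      (Q p \<inter> Q (other p) \<subseteq> U p \<and> D p = {}) \<or>
      (Q (other p) \<inter> Q p \<subseteq> U (other p) \<and> D (other p) = {})"
    using assms by (simp add: invar_def all_player_iff[of _ p] ex_player_iff[of _ p])
  then show "Q p \<inter> Q (other p) \<subseteq> U (other p)" "Q p \<inter> Q (other p) \<subseteq> U p \<or> D (other p) = {}"
    if "D p \<noteq> {}" using that by blast+
  show "t = card (Q p) + card (Q (other p)) + m"
    "s * m \<le> card (Q p - U p) + card (Q (other p) - U (other p))"
    using assms by (simp_all add: invar_def sum_players[of _ p])
qed

lemma invar_bound:
  assumes "invar L s D Q U m t" "L \<le> s * s" "s > 0"
  shows "t \<le> L + 2 * s"
proof -
  let ?B = "Player_B" and ?C = "Player_C"
  note sub = invarD(1-3)[OF assms(1)] and fin = invarD(4,5)[OF assms(1)]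
  have ov: "Q ?B \<inter> Q ?C \<subseteq> U ?B \<or> Q ?B \<inter> Q ?C \<subseteq> U ?C"
    using invarD(8,9)[OF assms(1), of ?B] assms(1)
    by (cases "D ?B = {}") (auto simp: invar_def all_player_iff[of _ ?B] ex_player_iff[of _ ?B])
  then have "card (Q ?B \<inter> Q ?C) \<le> s"
    using sub(3) fin by (meson card_mono le_trans)
  moreover have "card (Q ?B \<union> Q ?C) \<le> L"
    using sub(2) card_mono[of "{..<L}" "Q ?B \<union> Q ?C"] by simp
  moreover have "card (Q ?B) + card (Q ?C) = card (Q ?B \<union> Q ?C) + card (Q ?B \<inter> Q ?C)"
    using fin by (intro card_Un_Int)
  ultimately have "card (Q ?B) + card (Q ?C) \<le> L + s" by linarith
  moreover have "m \<le> s"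
  proof -
    have "s * m \<le> card (Q ?B - U ?B) + card (Q ?C - U ?C)"
      using assms(1) by (simp add: invar_def)
    \<comment> \<open>By \<open>ov\<close>, every doubly asked bit is unpublished for one of the
      players, so the two published sets are disjoint.\<close>
    also have "\<dots> = card ((Q ?B - U ?B) \<union> (Q ?C - U ?C))"
      using ov fin by (intro card_Un_disjoint[symmetric]) auto
    also have "\<dots> \<le> L"
      using sub(2) card_mono[of "{..<L}" "(Q ?B - U ?B) \<union> (Q ?C - U ?C)"] by force
    finally show ?thesis using assms(2,3) by (meson le_trans mult_le_cancel1)
  qed
  ultimately show ?thesis using assms(1) by (simp add: invar_def)
qed

section \<open>Preservation of the invariant\<close>

text \<open>Meant for \<open>p\<close> being the player who has just asked. After a YES the set
  \<open>U p\<close> is empty, and a bit asked by both is then accounted for by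
  \<open>D (other p) = {}\<close>.\<close>

lemma invarI:
  assumes "\<And>r. U r \<subseteq> Q r" "\<And>r. Q r \<subseteq> {..<L}" "\<And>r. card (U r) \<le> s"
    and "\<And>r. Q r \<inter> D (other r) \<subseteq> U r"
    and "\<And>r i. i \<in> Q r \<Longrightarrow> passed r i \<inter> D r = {}"
    and "Q p \<inter> Q (other p) \<subseteq> U (other p)"
    and "Q p \<inter> Q (other p) \<subseteq> U p \<or> D (other p) = {}"
    and "t = card (Q p) + card (Q (other p)) + m"
    and "s * m \<le> card (Q p - U p) + card (Q (other p) - U (other p))"
  shows "invar L s D Q U m t"
proof -
  have "(Q r - U r) \<inter> D (other r) = {}" for r using assms(4)[of r] by blast
  moreover have "(\<forall>r. Q r \<inter> Q (other r) \<subseteq> U r) \<or> (\<exists>r. Q r \<inter> Q (other r) \<subseteq> U r \<and> D r = {})"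
    unfolding all_player_iff[of _ p] ex_player_iff[of _ p]
    using assms(6,7) by (simp add: Int_commute) blast
  ultimately show ?thesis
    using assms(1-3,5,8,9) by (simp add: invar_def sum_players[of _ p])
qed

lemma invar_no:
  assumes inv: "invar L s D Q U m t"
    and i: "i \<in> D p" "i < L" "passed p i \<inter> D p \<subseteq> {i}"
    and u: "card (U p) < s"
    and D': "D' p \<subseteq> D p - {i}" "D' (other p) = D (other p)"
  shows "invar L s D' (Q(p := insert i (Q p))) (U(p := insert i (U p))) m (Suc t)"
proof -
  note I = invarD[OF inv]
  have ni: "i \<notin> Q p" "i \<notin> U p" using I(1)[of p] I(7)[of i p] i(1) passed_self[of i p] by blast+
  \<comment> \<open>The bit \<open>i\<close> is open for \<open>p\<close>, so \<open>other p\<close>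
    has not published it; if \<open>other p\<close> asked for it at all, it is still in
    \<open>U (other p)\<close>.\<close>
  have ov: "insert i (Q p) \<inter> Q (other p) \<subseteq> U (other p)"
    using I(6)[of "other p"] I(8)[of p] i(1) by auto
  have D'_subset: "D' r \<subseteq> D r" for r using D' player_cases[of r p] by blast
  show ?thesis
  proof (rule invarI[where p = p])
    fix r
    show "(U(p := insert i (U p))) r \<subseteq> (Q(p := insert i (Q p))) r" using I(1)[of r] by auto
    show "(Q(p := insert i (Q p))) r \<subseteq> {..<L}" using I(2)[of r] i(2) by auto
    show "card ((U(p := insert i (U p))) r) \<le> s" using I(3)[of r] I(5) ni(2) u by simp
    show "(Q(p := insert i (Q p))) r \<inter> D' (other r) \<subseteq> (U(p := insert i (U p))) r"
      using I(6)[of r] D'_subset[of "other r"] by auto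
    show "passed r j \<inter> D' r = {}" if "j \<in> (Q(p := insert i (Q p))) r" for j
      using that I(7)[of j r] D'_subset[of r] D'(1) i(3) by (cases "r = p") auto
  next
    show "(Q(p := insert i (Q p))) p \<inter> (Q(p := insert i (Q p))) (other p)
        \<subseteq> (U(p := insert i (U p))) p \<or> D' (other p) = {}"
      using I(9)[of p] i(1) D'(2) by auto
    \<comment> \<open>A NO publishes nothing, so the bits that pay for the forced answers are
      unchanged.\<close>
    have "insert i (Q p) - insert i (U p) = Q p - U p" using ni by blast
    then show "s * m \<le> card ((Q(p := insert i (Q p))) p - (U(p := insert i (U p))) p) +
        card ((Q(p := insert i (Q p))) (other p) - (U(p := insert i (U p))) (other p))"
      using I(11)[of p] by simp
  qed (use ov I(10)[of p] I(4) ni in auto)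
qed

text \<open>
  If a bit asked by both players precedes a YES, the other player learns all bits on one side of it
  and already knows those on the other side. This is the fact \<open>det\<close> in the next two proofs.
\<close>

lemma invar_yes:
  assumes inv: "invar L s D Q U m t"
    and i: "i \<in> D p" "i < L" "passed p i \<inter> D p \<subseteq> {i}"
    and D': "\<And>r. D' r \<subseteq> D p - {i}" "\<And>r. D' r \<subseteq> D r"
  shows "invar L s D' (Q(p := insert i (Q p))) (U(p := {})) m (Suc t)"
proof -
  note I = invarD[OF inv]
  have ni: "i \<notin> Q p" using I(7)[of i p] i(1) passed_self[of i p] by blast
  have ov: "insert i (Q p) \<inter> Q (other p) \<subseteq> U (other p)"
    using I(6)[of "other p"] I(8)[of p] i(1) by auto
  have passed: "passed r j \<inter> D' r = {}" if "j \<in> (Q(p := insert i (Q p))) r" for r j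
    using that I(7)[of j r] D'(2)[of r] D'(1)[of p] i(3) by (cases "r = p") (auto split: if_splits)
  \<comment> \<open>All bits asked by \<open>p\<close> are known to \<open>p\<close>, and the YES
    passes this knowledge on to \<open>other p\<close>. This is why \<open>U p\<close> may be
    emptied.\<close>
  have known: "(insert i (Q p)) \<inter> D' (other p) = {}"
    using I(7)[of _ p] passed_self[of _ p] D'(1)[of "other p"] by blast
  have det: "D' (other p) = {}" if "j \<in> insert i (Q p) \<inter> Q (other p)" for j
  proof -
    have "passed p j \<inter> (D p - {i}) = {}" using that I(7)[of j p] i(3) by blast
    then show ?thesis
      using passed_Un[of p j] I(7)[of j "other p"] that D'[of "other p"] by blast
  qed
  show ?thesis
  proof (rule invarI[where p = p])
    fix r
    show "(U(p := {})) r \<subseteq> (Q(p := insert i (Q p))) r" using I(1)[of r] by auto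
    show "(Q(p := insert i (Q p))) r \<subseteq> {..<L}" using I(2)[of r] i(2) by auto
    show "card ((U(p := {})) r) \<le> s" using I(3)[of r] by simp
    show "(Q(p := insert i (Q p))) r \<inter> D' (other r) \<subseteq> (U(p := {})) r"
      using I(6)[of r] D'(2)[of "other r"] known by auto
  next
    show "(Q(p := insert i (Q p))) p \<inter> (Q(p := insert i (Q p))) (other p) \<subseteq> (U(p := {})) p
        \<or> D' (other p) = {}"
      using det by auto
    have "card (Q p - U p) \<le> card (insert i (Q p))"
      using I(4)[of p] by (intro card_mono) auto
    then show "s * m \<le> card ((Q(p := insert i (Q p))) p - (U(p := {})) p) +
        card ((Q(p := insert i (Q p))) (other p) - (U(p := {})) (other p))"
      using I(11)[of p] by simp
  qed (use ov I(10)[of p] I(4)[of p] ni passed in auto)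
qed

lemma invar_forced_yes:
  assumes inv: "invar L s D Q U m t"
    and ne: "D p \<noteq> {}"
    and u: "card (U p) = s"
    and D': "\<And>r. D' r \<subseteq> D p" "\<And>r. D' r \<subseteq> D r"
  shows "invar L s D' Q (U(p := {})) (Suc m) (Suc t)"
proof -
  note I = invarD[OF inv]
  have passed: "passed r j \<inter> D' r = {}" if "j \<in> Q r" for r j
    using that I(7)[of j r] D'(2)[of r] by blast
  have known: "Q p \<inter> D' (other p) = {}"
    using I(7)[of _ p] passed_self[of _ p] D'(1)[of "other p"] by blast
  have det: "D' (other p) = {}" if "j \<in> Q p \<inter> Q (other p)" for j
    using passed_Un[of p j] I(7)[of j p] I(7)[of j "other p"] that D'[of "other p"] by blast
  show ?thesis
  proof (rule invarI[where p = p])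
    fix r
    show "(U(p := {})) r \<subseteq> Q r" using I(1)[of r] by auto
    show "Q r \<subseteq> {..<L}" using I(2) .
    show "card ((U(p := {})) r) \<le> s" using I(3)[of r] by simp
    show "Q r \<inter> D' (other r) \<subseteq> (U(p := {})) r"
      using I(6)[of r] D'(2)[of "other r"] known by auto
  next
    show "Q p \<inter> Q (other p) \<subseteq> (U(p := {})) p \<or> D' (other p) = {}"
      using det by auto
    \<comment> \<open>Emptying \<open>U p\<close> turns exactly \<open>s\<close> unpublished bits
      into published ones, which pay for the additional forced answer.\<close>
    have "card (Q p) = card (Q p - U p) + s"
      using I(1,4,5)[of p] u by (metis card_Diff_subset card_mono le_add_diff_inverse2)
    then show "s * Suc m \<le> card (Q p - (U(p := {})) p) +
        card (Q (other p) - (U(p := {})) (other p))"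
      using I(11)[of p] by simp
  qed (use ne I(8,10)[of p] passed in auto)
qed

section \<open>The strategy under an arbitrary order of questioners\<close>

text \<open>The first alternative absorbs the YES of a player who knows \<open>d\<close>, for which
  there need not be \<open>s\<close> unpublished bits to pay. The equation for
  \<open>card (U p)\<close> ties the bookkeeping set to the counter that the player reads off the
  view.\<close>

lemma meet_strategy_invar:
  fixes n L s d :: nat
  assumes "d < n"
  defines "S \<equiv> meet_strategy n L s"
  defines "D \<equiv> \<lambda>\<sigma> p. undetermined L (consistent_set {..<n} (views S d \<sigma> p))"
  shows "(\<forall>p. D \<sigma> p = {}) \<or>
    (\<exists>Q U m. invar L s (D \<sigma>) Q U m (length \<sigma>) \<and>
      (\<forall>p. card (U p) = unpublished (views S d \<sigma> p)))"
proof (induction \<sigma> rule: rev_induct)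
  case Nil
  have "invar L s (D []) (\<lambda>_. {}) (\<lambda>_. {}) 0 (length [])"
    by (simp add: invar_def)
  then show ?case by fastforce
next
  case (snoc p \<sigma>)
  let ?V = "views S d \<sigma>" and ?V' = "views S d (\<sigma> @ [p])"
  let ?K = "\<lambda>v. consistent_set {..<n} v"
  let ?R = "S p (?V p)" and ?i = "next_bit p (D \<sigma> p)"
  have dK: "d \<in> ?K (views S d \<tau> r)" for \<tau> r
    using assms(1) by (simp add: defective_consistent)
  have R: "?R = (if D \<sigma> p = {} \<or> unpublished (?V p) = s then ?K (?V p)
      else {x \<in> ?K (?V p). bit x ?i})"
    by (simp add: S_def meet_strategy_def D_def Let_def)
  have mono: "D (\<sigma> @ [p]) r \<subseteq> D \<sigma> r" for r
    unfolding D_def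
    by (intro undetermined_mono) (auto simp: views_snoc ask_def Let_def consistent_set_snoc)
  \<comment> \<open>After a YES the consistent sets of both players lie in \<open>?R\<close>, which
    in turn lies in the consistent set of the asking player.\<close>
  have yes: "D (\<sigma> @ [p]) r \<subseteq> undetermined L ?R" if "d \<in> ?R" for r
    unfolding D_def using that
    by (intro undetermined_mono) (auto simp: views_snoc ask_def Let_def consistent_set_snoc)
  show ?case
  proof (cases "\<forall>r. D \<sigma> r = {}")
    case True
    then show ?thesis using mono by blast
  next
    case False
    then obtain Q U m where inv: "invar L s (D \<sigma>) Q U m (length \<sigma>)"
      and u: "\<And>r. card (U r) = unpublished (?V r)"
      using snoc.IH by blast
    have us: "unpublished (?V p) \<le> s" using inv u by (metis invar_def)
    show ?thesis
    proof (cases "D \<sigma> p = {} \<or> unpublished (?V p) = s")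
      case forced: True
      then have R': "?R = ?K (?V p)" using R by simp
      then have dR: "d \<in> ?R" using dK by simp
      have sub: "D (\<sigma> @ [p]) r \<subseteq> D \<sigma> p" for r
        using yes[OF dR] R' by (simp add: D_def)
      show ?thesis
      proof (cases "D \<sigma> p = {}")
        case True
        \<comment> \<open>The asking player knew \<open>d\<close>, so this YES completes the
          knowledge of both.\<close>
        then show ?thesis using sub by blast
      next
        case False
        then have "invar L s (D (\<sigma> @ [p])) Q (U(p := {})) (Suc m) (Suc (length \<sigma>))"
          using forced u sub mono by (intro invar_forced_yes[OF inv]) auto
        moreover have "card ((U(p := {})) r) = unpublished (?V' r)" for r
          using dR u by (simp add: views_snoc ask_def Let_def)
        ultimately show ?thesis by fastforce
      qed
    next
      case False
      then have R': "?R = {x \<in> ?K (?V p). bit x ?i}" and ne: "D \<sigma> p \<noteq> {}" using R by auto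
      have fin: "finite (D \<sigma> p)"
        unfolding D_def using undetermined_lt finite_subset by blast
      have i: "?i \<in> D \<sigma> p" "passed p ?i \<inter> D \<sigma> p \<subseteq> {?i}"
        using fin ne next_bit_in passed_next_bit by auto
      then have iL: "?i < L" using undetermined_lt by (auto simp: D_def)
      show ?thesis
      proof (cases "d \<in> ?R")
        case True
        have "?i \<notin> undetermined L ?R" unfolding R' by (auto simp: undetermined_def)
        moreover have "undetermined L ?R \<subseteq> D \<sigma> p"
          unfolding D_def R' by (intro undetermined_mono) auto
        ultimately have "D (\<sigma> @ [p]) r \<subseteq> D \<sigma> p - {?i}" for r
          using yes[OF True, of r] by blast
        then have "invar L s (D (\<sigma> @ [p])) (Q(p := insert ?i (Q p))) (U(p := {})) m (Suc (length \<sigma>))"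
          using i iL mono by (intro invar_yes[OF inv]) auto
        moreover have "card ((U(p := {})) r) = unpublished (?V' r)" for r
          using True u by (simp add: views_snoc ask_def Let_def)
        ultimately show ?thesis by fastforce
      next
        case dR: False
        have "?K (?V' p) \<subseteq> {x. \<not> bit x ?i}"
          using dR R' by (auto simp: views_snoc ask_def Let_def consistent_set_snoc)
        then have "?i \<notin> D (\<sigma> @ [p]) p" by (auto simp: D_def undetermined_def)
        moreover have "D (\<sigma> @ [p]) (other p) = D \<sigma> (other p)"
          using dR by (simp add: D_def views_snoc ask_def Let_def)
        moreover have "card (U p) < s" using False us u by (simp add: le_neq_implies_less)
        ultimately have "invar L s (D (\<sigma> @ [p])) (Q(p := insert ?i (Q p)))
            (U(p := insert ?i (U p))) m (Suc (length \<sigma>))"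
          using i iL mono by (intro invar_no[OF inv]) auto
        moreover have "card ((U(p := insert ?i (U p))) r) = unpublished (?V' r)" for r
        proof -
          have "?i \<notin> U p"
            using inv i(1) passed_self[of ?i p] unfolding invar_def by blast
          moreover have "finite (U p)"
            using inv unfolding invar_def by (meson finite_lessThan finite_subset)
          ultimately show ?thesis using dR u by (simp add: views_snoc ask_def Let_def)
        qed
        ultimately show ?thesis by fastforce
      qed
    qed
  qed
qed

section \<open>The query bound and the choice of parameters\<close>

lemma meet_strategy_guarantees:
  assumes "n \<le> 2 ^ L" "L \<le> s * s" "s > 0"
  shows "guarantees {..<n} (meet_strategy n L s) (L + 2 * s + 1)"
  unfolding guarantees_def
proof (intro ballI allI impI)
  fix d and \<sigma> :: "player list"
  assume "d \<in> {..<n}" and len: "length \<sigma> = L + 2 * s + 1"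
  then have d: "d < n" by simp
  let ?K = "\<lambda>p. consistent_set {..<n} (views (meet_strategy n L s) d \<sigma> p)"
  \<comment> \<open>The invariant allows at most \<open>L + 2 * s\<close> queries while a bit is
    open; one more query rules out its alternative.\<close>
  have "\<forall>p. undetermined L (?K p) = {}"
    using meet_strategy_invar[OF d, of L s \<sigma>] invar_bound[OF _ assms(2,3)] len by fastforce
  moreover have "d \<in> ?K p" "?K p \<subseteq> {..<2 ^ L}" for p
    using d assms(1) consistent_set_subset[of "{..<n}"] defective_consistent[of d "{..<n}"]
    by fastforce+
  ultimately have "?K p = {d}" for p
    by (metis undetermined_empty_iff)
  then have "goal_reached {..<n} (meet_strategy n L s) d \<sigma>"
    using d by (intro goal_reachedI) auto
  then show "\<exists>t\<le>L + 2 * s + 1. goal_reached {..<n} (meet_strategy n L s) d (take t \<sigma>)"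
    using len by (metis order_refl take_all)
qed

theorem theorem6:
  fixes n :: nat
  assumes "n \<ge> 2"
  shows "int (f6 n) \<le> \<lceil>log 2 (real n)\<rceil> + 2 * \<lceil>sqrt (log 2 (real n))\<rceil> + 2"
proof -
  define l where "l = log 2 (real n)"
  define L where "L = nat \<lceil>l\<rceil>"
  define s where "s = nat \<lceil>sqrt l\<rceil>"
  \<comment> \<open>This makes both ceilings positive, so that \<open>nat\<close> preserves them and
    \<open>s > 0\<close>.\<close>
  have l: "l \<ge> 1" using assms by (simp add: l_def le_log_iff)
  then have "sqrt l \<ge> 1" by simp
  then have sl: "\<lceil>sqrt l\<rceil> \<ge> 1" by linarith
  have L: "real L \<ge> l" "int L = \<lceil>l\<rceil>" using l by (auto simp: L_def)
  have s: "real s \<ge> sqrt l" "int s = \<lceil>sqrt l\<rceil>"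
    using sl real_nat_ceiling_ge by (auto simp only: s_def int_nat_eq split: if_splits)
  have "s > 0" using sl s(2) by linarith
  have "real n = 2 powr l" using assms by (simp add: l_def)
  also have "\<dots> \<le> 2 powr real L" using L by simp
  finally have "n \<le> 2 ^ L" by (simp add: powr_realpow)
  have "l \<le> real s * real s"
    using sqrt_le_D[OF s(1)] by (simp add: power2_eq_square)
  \<comment> \<open>Since \<open>s * s\<close> is an integer, the bound on \<open>l\<close> survives
    rounding \<open>l\<close> up.\<close>
  then have "L \<le> s * s"
    by (simp add: L_def nat_le_iff ceiling_le_iff)
  have "f6 n \<le> L + 2 * s + 1"
    unfolding f6_def
    using strategy_on_meet_strategy meet_strategy_guarantees[OF \<open>n \<le> 2 ^ L\<close> \<open>L \<le> s * s\<close> \<open>s > 0\<close>]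
    by (intro Least_le) blast
  then have "int (f6 n) \<le> int L + 2 * int s + 1" by linarith
  then show ?thesis using L(2) s(2) by (simp add: l_def)
qed

end
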